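(* For any $c < 1/2$, there is a deterministic non-adaptive algorithm that, for every undirected graph on $[n]$ with non-negative edge weights, makes $\frac{4}{(1-2c)^2}\log n$ cut queries and outputs a set $T \subseteq [n]$ with $F(T) \ge c \max_{S \subseteq [n]} F(S)$. In particular, the deterministic non-adaptive query complexity of $c$-approximate max-cut in the cut finding setting is $O(\log n)$.
   Context: Cut query model: an undirected graph on $[n]$ has non-negative edge weights $w_{i,j}$ and cut function $F(S) = \sum_{i \in S, j \notin S} w_{i,j}$; an algorithm accesses the graph only by submitting sets $S$ and receiving $F(S)$, with unlimited computation. Non-adaptive means all query sets are fixed before any answer is seen. $\log$ is the natural logarithm. *)

theory Defs
  imports Complex_Main "HOL-Library.Landau_Symbols"
begin

(* An undirected graph on [n] = {1..n} is given by its weights, weight 0 meaning "no edge".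
   Diagonal entries are left unconstrained: they never enter the cut function.
   Entries outside {1..n} are irrelevant too. *)
definition weighted_graph :: "nat \<Rightarrow> (nat \<Rightarrow> nat \<Rightarrow> real) \<Rightarrow> bool" where
  "weighted_graph n w \<longleftrightarrow>
     (\<forall>i\<in>{1..n}. \<forall>j\<in>{1..n}. w i j = w j i \<and> w i j \<ge> 0)"

definition cut_value :: "nat \<Rightarrow> (nat \<Rightarrow> nat \<Rightarrow> real) \<Rightarrow> nat set \<Rightarrow> real" where
  "cut_value n w S = (\<Sum>i\<in>S. \<Sum>j\<in>{1..n} - S. w i j)"

definition max_cut :: "nat \<Rightarrow> (nat \<Rightarrow> nat \<Rightarrow> real) \<Rightarrow> real" where
  "max_cut n w = Max (cut_value n w ` Pow {1..n})"

(* A deterministic non-adaptive algorithm with unlimited computation: the queries are fixed in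
   advance, and the output is an arbitrary function of the list of answers (and of nothing else). *)
datatype algorithm = Algorithm (queries: "nat set list") (decide: "real list \<Rightarrow> nat set")

definition algorithm_on :: "nat \<Rightarrow> algorithm \<Rightarrow> bool" where
  "algorithm_on n A \<longleftrightarrow> (\<forall>S\<in>set (queries A). S \<subseteq> {1..n})"

definition num_queries :: "algorithm \<Rightarrow> nat" where
  "num_queries A = length (queries A)"

definition run :: "algorithm \<Rightarrow> (nat set \<Rightarrow> real) \<Rightarrow> nat set" where
  "run A F = decide A (map F (queries A))"

definition finds_approx_max_cut :: "real \<Rightarrow> nat \<Rightarrow> algorithm \<Rightarrow> bool" where
  "finds_approx_max_cut c n A \<longleftrightarrow>
     (\<forall>w. weighted_graph n w \<longrightarrow>
        run A (cut_value n w) \<subseteq> {1..n} \<and>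
        cut_value n w (run A (cut_value n w)) \<ge> c * max_cut n w)"

(* The deterministic non-adaptive query complexity in the cut finding setting, where a set has
   to be output rather than just a value. The minimum is over a nonempty set whenever c \<le> 1,
   as querying all subsets of {1..n} reveals a maximum cut. *)
definition query_complexity :: "real \<Rightarrow> nat \<Rightarrow> nat" where
  "query_complexity c n =
     (LEAST k. \<exists>A. algorithm_on n A \<and> finds_approx_max_cut c n A \<and> num_queries A = k)"

end

theory Submission
  imports Defs
begin

text \<open>Call a pair of vertices separated by a set if exactly one of the two lies in the set. If every
  pair is separated by at least a fraction \<open>c\<close> of the queried sets, then the average answer is at least
  \<open>c\<close> times the total weight, so the query with the largest answer is a valid output. Choosing the
  sets greedily by the method of conditional expectations, with the sum over all pairs of
  \<open>exp (- e * (separations - non-separations))\<close> and \<open>e = 1 - 2 * c\<close> as a pessimistic estimator,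
  gives such a family: a uniformly random set multiplies each summand by \<open>cosh e \<le> exp (e\<^sup>2 / 2)\<close>
  in expectation.\<close>

definition separates :: "'a set \<Rightarrow> 'a \<Rightarrow> 'a \<Rightarrow> bool" where
  "separates S i j \<longleftrightarrow> (i \<in> S \<longleftrightarrow> j \<notin> S)"

text \<open>The signs are chosen for the exponential moment: for independent uniformly random
  subsets of a finite set containing distinct \<open>i\<close> and \<open>j\<close>, this is a sum
  of independent symmetric signs, so its moment generating function is a power of cosh.\<close>

definition separation_bias :: "'a set list \<Rightarrow> 'a \<Rightarrow> 'a \<Rightarrow> real" where
  "separation_bias Ss i j = (\<Sum>S\<leftarrow>Ss. if separates S i j then 1 else -1)"

lemma separation_bias_eq:
  "separation_bias Ss i j = 2 * (\<Sum>S\<leftarrow>Ss. of_bool (separates S i j)) - real (length Ss)"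
  by (induction Ss) (auto simp: separation_bias_def)

section \<open>Gaussian bound on cosh\<close>

lemma tanh_le_self:
  assumes "x \<ge> 0"
  shows "tanh x \<le> (x::real)"
proof -
  have "0 - tanh 0 \<le> x - tanh x"
  proof (rule DERIV_nonneg_imp_nondecreasing[OF assms])
    fix y :: real
    have "((\<lambda>x. x - tanh x) has_real_derivative (tanh y)\<^sup>2) (at y)"
      using cosh_real_pos[of y] by (auto intro!: derivative_eq_intros)
    thus "\<exists>d. ((\<lambda>x. x - tanh x) has_real_derivative d) (at y) \<and> 0 \<le> d"
      by force
  qed
  thus ?thesis by simp
qed

text \<open>Taking logarithms, the gap \<open>x\<^sup>2 / 2 - ln (cosh x)\<close> vanishes at 0 and
  has derivative \<open>x - tanh x\<close>, which is nonnegative for x \<ge> 0.\<close>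

lemma cosh_le_exp_half_square:
  assumes "x \<ge> 0"
  shows "cosh x \<le> exp (x\<^sup>2 / (2::real))"
proof -
  have "0\<^sup>2 / 2 - ln (cosh 0) \<le> x\<^sup>2 / 2 - ln (cosh x)"
  proof (rule DERIV_nonneg_imp_nondecreasing[OF assms])
    fix y :: real assume "0 \<le> y"
    have "((\<lambda>x. x\<^sup>2 / 2 - ln (cosh x)) has_real_derivative (y - tanh y)) (at y)"
      using cosh_real_pos[of y] by (auto intro!: derivative_eq_intros simp: tanh_def)
    thus "\<exists>d. ((\<lambda>x. x\<^sup>2 / 2 - ln (cosh x)) has_real_derivative d) (at y) \<and> 0 \<le> d"
      using tanh_le_self[OF \<open>0 \<le> y\<close>] by force
  qed
  hence "ln (cosh x) \<le> x\<^sup>2 / 2" by simp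
  thus ?thesis
    by (metis cosh_real_pos exp_le_cancel_iff exp_ln)
qed

section \<open>Greedy construction of a separating family\<close>

lemma sum_Pow_exp_separates:
  fixes x :: real
  assumes "finite V" "i \<in> V" "i \<noteq> j"
  shows "(\<Sum>S\<in>Pow V. exp (- x * (if separates S i j then 1 else -1))) = card (Pow V) * cosh x"
    (is "(\<Sum>S\<in>_. ?f S) = _")
proof -
  \<comment> \<open>Toggling the membership of \<open>i\<close> is an involution of
    \<open>Pow V\<close> that turns separating sets into non-separating ones, so each set and its
    image together contribute \<open>exp x + exp (- x)\<close>.\<close>
  let ?flip = "\<lambda>S. if i \<in> S then S - {i} else insert i S"
  have flip: "(\<Sum>S\<in>Pow V. ?f S) = (\<Sum>S\<in>Pow V. ?f (?flip S))"
    by (rule sum.reindex_bij_witness[of _ ?flip ?flip])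
       (use assms in \<open>auto simp: insert_absorb\<close>)
  have "2 * (\<Sum>S\<in>Pow V. ?f S) = (\<Sum>S\<in>Pow V. ?f S + ?f (?flip S))"
    unfolding sum.distrib using flip by simp
  also have "\<dots> = (\<Sum>S\<in>Pow V. 2 * cosh x)"
    using assms by (intro sum.cong) (auto simp: separates_def cosh_field_def)
  finally show ?thesis by simp
qed

lemma exists_le_average:
  fixes f :: "'a \<Rightarrow> real" and b :: real
  assumes "finite A" "A \<noteq> {}" "sum f A \<le> card A * b"
  shows "\<exists>a\<in>A. f a \<le> b"
proof (rule ccontr)
  assume "\<not> ?thesis"
  hence "(\<Sum>a\<in>A. b) < sum f A"
    using assms by (intro sum_strict_mono) auto
  thus False using assms by simp
qed

text \<open>One set is prepended per induction step. Averaged over all of \<open>Pow V\<close>, the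
  new set multiplies every summand by \<open>cosh x\<close>, hence also their total, so a single set
  can be chosen that does no worse for the whole of \<open>P\<close>.\<close>

lemma exists_small_potential:
  fixes x :: real
  assumes V: "finite V" and P: "finite P" "P \<subseteq> {(i, j). i \<in> V \<and> i \<noteq> j}"
  shows "\<exists>Ss. length Ss = k \<and> set Ss \<subseteq> Pow V \<and>
           (\<Sum>(i, j)\<in>P. exp (- x * separation_bias Ss i j)) \<le> card P * cosh x ^ k"
proof (induction k)
  case 0
  show ?case by (simp add: separation_bias_def case_prod_unfold)
next
  case (Suc k)
  then obtain Ss where Ss: "length Ss = k" "set Ss \<subseteq> Pow V"
    and le: "(\<Sum>(i, j)\<in>P. exp (- x * separation_bias Ss i j)) \<le> card P * cosh x ^ k"
    by blast
  let ?pot = "\<lambda>Ss. \<Sum>(i, j)\<in>P. exp (- x * separation_bias Ss i j)"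
  let ?d = "\<lambda>S i j. if separates S i j then 1 else - 1 :: real"
  have "(\<Sum>S\<in>Pow V. ?pot (S # Ss)) =
        (\<Sum>(i, j)\<in>P. \<Sum>S\<in>Pow V. exp (- x * separation_bias Ss i j) * exp (- x * ?d S i j))"
    unfolding case_prod_unfold
    by (subst sum.swap)
       (simp add: separation_bias_def algebra_simps exp_add[symmetric] del: exp_add)
  also have "\<dots> = (\<Sum>(i, j)\<in>P. exp (- x * separation_bias Ss i j) * (card (Pow V) * cosh x))"
  proof (rule sum.cong[OF refl], clarify)
    fix i j assume "(i, j) \<in> P"
    with P have "i \<in> V" "i \<noteq> j" by auto
    show "(\<Sum>S\<in>Pow V. exp (- x * separation_bias Ss i j) * exp (- x * ?d S i j)) =
          exp (- x * separation_bias Ss i j) * (card (Pow V) * cosh x)"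
      unfolding sum_distrib_left[symmetric]
      by (subst sum_Pow_exp_separates[OF V \<open>i \<in> V\<close> \<open>i \<noteq> j\<close>]) rule
  qed
  also have "\<dots> = card (Pow V) * (cosh x * ?pot Ss)"
    by (simp add: sum_distrib_left sum_distrib_right case_prod_unfold mult_ac)
  also have "\<dots> \<le> card (Pow V) * (cosh x * (card P * cosh x ^ k))"
    using le cosh_real_pos[of x] by (intro mult_left_mono) auto
  finally have "\<exists>S\<in>Pow V. ?pot (S # Ss) \<le> cosh x * (card P * cosh x ^ k)"
    using V by (intro exists_le_average) auto
  then obtain S where "S \<in> Pow V" "?pot (S # Ss) \<le> card P * cosh x ^ Suc k"
    by (auto simp: mult_ac)
  thus ?case using Ss by (intro exI[of _ "S # Ss"]) auto
qed

text \<open>A pair separated too rarely has bias at most \<open>- e * k\<close> and so alone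
  contributes at least \<open>exp (e\<^sup>2 * k)\<close> to the potential, which exceeds the
  available bound \<open>(card V)\<^sup>2 * exp (e\<^sup>2 * k / 2)\<close>.\<close>

lemma exists_separating_family:
  fixes c :: real
  assumes c: "c < 1/2" and V: "finite V"
    and k: "(real (card V))\<^sup>2 < 2 * exp ((1 - 2 * c)\<^sup>2 * real k / 2)"
  shows "\<exists>Ss. length Ss = k \<and> set Ss \<subseteq> Pow V \<and>
           (\<forall>i\<in>V. \<forall>j\<in>V. i \<noteq> j \<longrightarrow> c * real k \<le> (\<Sum>S\<leftarrow>Ss. of_bool (separates S i j)))"
proof -
  define e where "e = 1 - 2 * c"
  have e: "e > 0" using c by (simp add: e_def)
  define P where "P = {(i, j). i \<in> V \<and> j \<in> V \<and> i \<noteq> j}"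
  have PV: "P \<subseteq> V \<times> V" by (auto simp: P_def)
  have finP: "finite P" using PV V by (meson finite_SigmaI finite_subset)
  have cardP: "real (card P) \<le> (real (card V))\<^sup>2"
    using card_mono[OF _ PV] V by (simp add: card_cartesian_product power2_eq_square flip: of_nat_mult)
  have "P \<subseteq> {(i, j). i \<in> V \<and> i \<noteq> j}" by (auto simp: P_def)
  from exists_small_potential[OF V finP this, of k e]
  obtain Ss where Ss: "length Ss = k" "set Ss \<subseteq> Pow V"
    and pot: "(\<Sum>(i, j)\<in>P. exp (- e * separation_bias Ss i j)) \<le> card P * cosh e ^ k"
    by blast
  have "c * real k \<le> (\<Sum>S\<leftarrow>Ss. of_bool (separates S i j))" if ij: "i \<in> V" "j \<in> V" "i \<noteq> j" for i j
  proof (rule ccontr)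
    assume "\<not> ?thesis"
    hence bias: "separation_bias Ss i j \<le> - e * real k"
      by (simp add: separation_bias_eq Ss e_def algebra_simps)
    have sym: "separation_bias Ss j i = separation_bias Ss i j"
      unfolding separation_bias_def
      by (intro arg_cong[of _ _ sum_list] map_cong refl) (auto simp: separates_def)
    have "e * (e * real k) \<le> e * - separation_bias Ss i j"
      using bias e by (intro mult_left_mono) auto
    hence "2 * exp (e\<^sup>2 * real k) \<le> 2 * exp (- e * separation_bias Ss i j)"
      by (simp add: power2_eq_square mult_ac)
    \<comment> \<open>\<open>P\<close> consists of ordered pairs, so a bad pair is counted in both
      orders; this is the source of the factor 2 in the assumption on \<open>k\<close>.\<close>
    also have "\<dots> = (\<Sum>(i, j)\<in>{(i, j), (j, i)}. exp (- e * separation_bias Ss i j))"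
      using ij sym by simp
    also have "\<dots> \<le> (\<Sum>(i, j)\<in>P. exp (- e * separation_bias Ss i j))"
      using ij finP by (intro sum_mono2) (auto simp: P_def)
    also have "\<dots> \<le> (real (card V))\<^sup>2 * exp (e\<^sup>2 / 2) ^ k"
      using cardP e cosh_le_exp_half_square[of e] cosh_real_pos[of e]
      by (intro order.trans[OF pot] mult_mono power_mono) auto
    also have "exp (e\<^sup>2 / 2) ^ k = exp (e\<^sup>2 * real k / 2)"
      by (simp add: mult_ac flip: exp_of_nat_mult)
    also have "(real (card V))\<^sup>2 * \<dots> < 2 * exp (e\<^sup>2 * real k / 2) * exp (e\<^sup>2 * real k / 2)"
      using k by (simp add: e_def)
    also have "\<dots> = 2 * exp (e\<^sup>2 * real k)"
      by (simp flip: exp_add)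
    finally show False by simp
  qed
  with Ss show ?thesis by blast
qed

section \<open>Cut values in terms of separated pairs\<close>

lemma cut_value_eq_separates:
  assumes w: "weighted_graph n w" and S: "S \<subseteq> {1..n}"
  shows "2 * cut_value n w S = (\<Sum>i=1..n. \<Sum>j=1..n. w i j * of_bool (separates S i j))"
proof -
  have 1: "cut_value n w S = (\<Sum>i=1..n. \<Sum>j=1..n. w i j * of_bool (i \<in> S \<and> j \<notin> S))"
  proof -
    have "cut_value n w S = (\<Sum>i\<in>S. \<Sum>j=1..n. w i j * of_bool (i \<in> S \<and> j \<notin> S))"
      unfolding cut_value_def by (intro sum.cong sum.mono_neutral_cong_left) auto
    also have "\<dots> = (\<Sum>i=1..n. \<Sum>j=1..n. w i j * of_bool (i \<in> S \<and> j \<notin> S))"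
      using S by (intro sum.mono_neutral_left) auto
    finally show ?thesis .
  qed
  \<comment> \<open>Symmetry of \<open>w\<close> allows the two sides of the cut to be exchanged.
    Adding both orientations covers exactly the separated ordered pairs; diagonal entries drop
    out.\<close>
  also have "\<dots> = (\<Sum>i=1..n. \<Sum>j=1..n. w i j * of_bool (j \<in> S \<and> i \<notin> S))"
    using w by (subst sum.swap, intro sum.cong) (auto simp: weighted_graph_def)
  finally have "2 * cut_value n w S = (\<Sum>i=1..n. \<Sum>j=1..n. w i j * of_bool (i \<in> S \<and> j \<notin> S)) +
      (\<Sum>i=1..n. \<Sum>j=1..n. w i j * of_bool (j \<in> S \<and> i \<notin> S))"
    using 1 by simp
  also have "\<dots> = (\<Sum>i=1..n. \<Sum>j=1..n. w i j * of_bool (separates S i j))"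
    unfolding sum.distrib[symmetric] by (intro sum.cong) (auto simp: separates_def)
  finally show ?thesis .
qed

lemma cut_value_nonneg:
  assumes "weighted_graph n w" "S \<subseteq> {1..n}"
  shows "cut_value n w S \<ge> 0"
  unfolding cut_value_def
  using assms by (intro sum_nonneg) (auto simp: weighted_graph_def)

lemma max_cut_attained:
  obtains S where "S \<subseteq> {1..n}" "cut_value n w S = max_cut n w"
proof -
  have "max_cut n w \<in> cut_value n w ` Pow {1..n}"
    unfolding max_cut_def by (intro Max_in) auto
  thus ?thesis using that by auto
qed

lemma sum_sum_list_swap: "(\<Sum>x\<leftarrow>xs. \<Sum>i\<in>A. f x i) = (\<Sum>i\<in>A. \<Sum>x\<leftarrow>xs. f x i)"
  for f :: "'a \<Rightarrow> 'b \<Rightarrow> 'c::comm_monoid_add"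
  by (induction xs) (auto simp: sum.distrib)

text \<open>Compared weight by weight with a maximum cut \<open>T\<close>: each pair that
  \<open>T\<close> separates is separated by a fraction \<open>c\<close> of the family as
  well.\<close>

lemma separating_family_cut_values:
  fixes c :: real
  assumes w: "weighted_graph n w" and Ss: "set Ss \<subseteq> Pow {1..n}"
    and c: "c \<ge> 0"
    and sep: "\<And>i j. i \<in> {1..n} \<Longrightarrow> j \<in> {1..n} \<Longrightarrow> i \<noteq> j \<Longrightarrow>
                c * real (length Ss) \<le> (\<Sum>S\<leftarrow>Ss. of_bool (separates S i j))"
  shows "real (length Ss) * (c * max_cut n w) \<le> (\<Sum>S\<leftarrow>Ss. cut_value n w S)"
proof -
  let ?k = "real (length Ss)"
  obtain T where T: "T \<subseteq> {1..n}" "cut_value n w T = max_cut n w"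
    by (rule max_cut_attained)
  have "2 * (?k * (c * max_cut n w)) = (c * ?k) * (2 * cut_value n w T)"
    by (simp add: T)
  also have "\<dots> = (\<Sum>i=1..n. \<Sum>j=1..n. w i j * (c * ?k * of_bool (separates T i j)))"
    unfolding cut_value_eq_separates[OF w T(1)] sum_distrib_left by (simp add: mult_ac)
  also have "\<dots> \<le> (\<Sum>i=1..n. \<Sum>j=1..n. w i j * (\<Sum>S\<leftarrow>Ss. of_bool (separates S i j)))"
  proof (intro sum_mono mult_left_mono)
    fix i j assume ij: "i \<in> {1..n}" "j \<in> {1..n}"
    show "0 \<le> w i j" using w ij by (auto simp: weighted_graph_def)
    \<comment> \<open>Nonnegativity settles the pairs that \<open>T\<close> does not separate, among
      them \<open>i = j\<close>, about which \<open>sep\<close> says nothing.\<close>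
    have "0 \<le> (\<Sum>S\<leftarrow>Ss. of_bool (separates S i j) :: real)"
      by (intro sum_list_nonneg) auto
    thus "c * ?k * of_bool (separates T i j) \<le> (\<Sum>S\<leftarrow>Ss. of_bool (separates S i j))"
      using sep[OF ij] by (auto simp: separates_def)
  qed
  also have "\<dots> = (\<Sum>S\<leftarrow>Ss. \<Sum>i=1..n. \<Sum>j=1..n. w i j * of_bool (separates S i j))"
    by (simp only: sum_sum_list_swap sum_list_const_mult)
  also have "\<dots> = (\<Sum>S\<leftarrow>Ss. 2 * cut_value n w S)"
    using Ss cut_value_eq_separates[OF w] by (intro arg_cong[of _ _ sum_list] map_cong) auto
  finally show ?thesis by (simp add: sum_list_const_mult)
qed

section \<open>From a separating family to an algorithm\<close>

lemma sum_list_less_const: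
  fixes f :: "'a \<Rightarrow> real"
  assumes "xs \<noteq> []" "\<And>x. x \<in> set xs \<Longrightarrow> f x < b"
  shows "(\<Sum>x\<leftarrow>xs. f x) < real (length xs) * b"
  using assms by (induction xs rule: list_nonempty_induct) (auto simp: algebra_simps intro: add_strict_mono)

lemma exists_algorithm_of_separating_family:
  fixes c :: real
  assumes "Ss \<noteq> []" and Ss: "set Ss \<subseteq> Pow {1..n}" and c: "c \<ge> 0"
    and sep: "\<And>i j. i \<in> {1..n} \<Longrightarrow> j \<in> {1..n} \<Longrightarrow> i \<noteq> j \<Longrightarrow>
                c * real (length Ss) \<le> (\<Sum>S\<leftarrow>Ss. of_bool (separates S i j))"
  shows "\<exists>A. algorithm_on n A \<and> num_queries A = length Ss \<and> finds_approx_max_cut c n A"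
proof -
  \<comment> \<open>The decision sees only the answers, so it picks a position holding the largest
    one and returns the query at that position.\<close>
  define A where "A = Algorithm Ss (\<lambda>vs. Ss ! (SOME t. t < length vs \<and> vs ! t = Max (set vs)))"
  have "run A (cut_value n w) \<subseteq> {1..n} \<and> c * max_cut n w \<le> cut_value n w (run A (cut_value n w))"
    if w: "weighted_graph n w" for w
  proof -
    define vs where "vs = map (cut_value n w) Ss"
    have "Max (set vs) \<in> set vs" using assms(1) by (intro Max_in) (auto simp: vs_def)
    hence "\<exists>t. t < length vs \<and> vs ! t = Max (set vs)" by (simp add: in_set_conv_nth)
    then obtain t where t: "t < length vs" "vs ! t = Max (set vs)" and "run A (cut_value n w) = Ss ! t"
      unfolding run_def A_def using someI_ex[of "\<lambda>t. t < length vs \<and> vs ! t = Max (set vs)"]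
      by (auto simp: vs_def)
    moreover have "c * max_cut n w \<le> vs ! t"
    proof (rule ccontr)
      assume less: "\<not> ?thesis"
      have "cut_value n w S < c * max_cut n w" if "S \<in> set Ss" for S
      proof -
        have "cut_value n w S \<le> Max (set vs)"
          using that by (intro Max_ge) (auto simp: vs_def)
        with less t(2) show ?thesis by linarith
      qed
      hence "(\<Sum>S\<leftarrow>Ss. cut_value n w S) < real (length Ss) * (c * max_cut n w)"
        using assms(1) by (intro sum_list_less_const)
      with separating_family_cut_values[OF w Ss c sep] show False by simp
    qed
    moreover have "Ss ! t \<in> Pow {1..n}"
      using t(1) by (intro subsetD[OF Ss] nth_mem) (simp add: vs_def)
    ultimately show ?thesis using t(1) by (simp add: vs_def)
  qed
  moreover have "algorithm_on n A" "num_queries A = length Ss"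
    using Ss by (auto simp: A_def algorithm_on_def num_queries_def)
  ultimately show ?thesis unfolding finds_approx_max_cut_def by blast
qed

text \<open>The empty set has cut value 0, which is enough when the target is nonpositive. For
  \<open>n = 1\<close> the bound \<open>ln n\<close> is 0 and permits no query at all.\<close>

lemma exists_algorithm_without_queries:
  assumes "c \<le> 0 \<or> n = 1"
  shows "\<exists>A. algorithm_on n A \<and> num_queries A = 0 \<and> finds_approx_max_cut c n A"
proof -
  define A where "A = Algorithm [] (\<lambda>_. {})"
  have "c * max_cut n w \<le> 0" if w: "weighted_graph n w" for w
  proof -
    obtain T where T: "T \<subseteq> {1..n}" "cut_value n w T = max_cut n w"
      by (rule max_cut_attained)
    have "max_cut n w = 0" if "n = 1"
      using T that by (auto simp: cut_value_def subset_singleton_iff)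
    moreover have "max_cut n w \<ge> 0" using cut_value_nonneg[OF w T(1)] T by simp
    ultimately show ?thesis using assms by (auto simp: mult_nonpos_nonneg)
  qed
  hence "finds_approx_max_cut c n A"
    by (simp add: finds_approx_max_cut_def A_def run_def cut_value_def)
  thus ?thesis
    by (intro exI[of _ A]) (simp add: A_def algorithm_on_def num_queries_def)
qed

section \<open>Choice of the number of queries\<close>

lemma exists_approx_max_cut_algorithm:
  fixes c :: real
  assumes c: "c < 1/2" and n: "n \<ge> 1"
  shows "\<exists>A. algorithm_on n A \<and> real (num_queries A) \<le> 4 / (1 - 2 * c)\<^sup>2 * ln (real n) \<and>
             finds_approx_max_cut c n A"
proof (cases "c \<le> 0 \<or> n = 1")
  case True
  moreover have "0 \<le> 4 / (1 - 2 * c)\<^sup>2 * ln (real n)" using n by simp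
  ultimately show ?thesis using exists_algorithm_without_queries[OF True] by force
next
  case False
  define e where "e = 1 - 2 * c"
  have e: "0 < e" "e < 1" using False c by (auto simp: e_def)
  have e2: "0 < e\<^sup>2" "e\<^sup>2 < 1" using e by (auto simp: power_less_one_iff)
  define B where "B = 4 / e\<^sup>2 * ln (real n)"
  \<comment> \<open>The query bound forces rounding down. This costs less than
    \<open>e\<^sup>2 / 2 < 1/2\<close> in the exponent \<open>e\<^sup>2 * k / 2\<close>, which the
    factor 2 of the potential argument absorbs because \<open>ln 2\<close> is at least 1/2.\<close>
  define k where "k = nat \<lfloor>B\<rfloor>"
  have ln_2: "ln 2 \<ge> (1/2::real)"
    using iffD2[OF ln_ge_iff exp_half_le2] by simp
  have ln_n: "ln (real n) \<ge> 1/2"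
  proof -
    have "ln 2 \<le> ln (real n)" using False n by simp
    thus ?thesis using ln_2 by linarith
  qed
  have "4 * ln (real n) \<le> B"
    using e2 ln_n by (simp add: B_def field_simps)
  \<comment> \<open>Ensures \<open>k \<ge> 1\<close>, so that there is a query to return.\<close>
  hence B: "B > 1" using ln_n by linarith
  have k: "real k \<le> B" "real k > B - 1" "k \<ge> 1"
    using B unfolding k_def by linarith+
  have "(real (card {1..n}))\<^sup>2 < 2 * exp (e\<^sup>2 * real k / 2)"
  proof -
    have "e\<^sup>2 * (B - 1) \<le> e\<^sup>2 * real k"
      using k e2 by (intro mult_left_mono) auto
    moreover have "e\<^sup>2 * (B - 1) = 4 * ln (real n) - e\<^sup>2"
      using e by (simp add: B_def field_simps)
    ultimately have "4 * ln (real n) - e\<^sup>2 \<le> e\<^sup>2 * real k"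
      by simp
    hence "2 * ln (real n) - ln 2 < e\<^sup>2 * real k / 2"
      using e2 ln_2 by linarith
    hence "exp (2 * ln (real n)) < exp (ln 2 + e\<^sup>2 * real k / 2)"
      by simp
    thus ?thesis using n by (simp add: exp_add exp_double)
  qed
  from exists_separating_family[OF c _ this[unfolded e_def]]
  obtain Ss where Ss: "length Ss = k" "set Ss \<subseteq> Pow {1..n}"
    "\<forall>i\<in>{1..n}. \<forall>j\<in>{1..n}. i \<noteq> j \<longrightarrow> c * real k \<le> (\<Sum>S\<leftarrow>Ss. of_bool (separates S i j))"
    by auto
  have "Ss \<noteq> []" "c \<ge> 0" using Ss k False by auto
  from exists_algorithm_of_separating_family[OF this(1) Ss(2) this(2)] Ss
  obtain A where "algorithm_on n A" "num_queries A = k" "finds_approx_max_cut c n A"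
    by auto
  thus ?thesis using k by (auto simp: B_def e_def)
qed

theorem theoremE4:
  fixes c :: real
  assumes "c < 1/2"
  shows "(\<forall>n::nat. n \<ge> 1 \<longrightarrow>
            (\<exists>A. algorithm_on n A \<and>
                 real (num_queries A) \<le> 4 / (1 - 2 * c)\<^sup>2 * ln (real n) \<and>
                 finds_approx_max_cut c n A)) \<and>
         (\<lambda>n. real (query_complexity c n)) \<in> O(\<lambda>n. ln (real n))"
proof (intro conjI allI impI)
  fix n :: nat assume "n \<ge> 1"
  with assms show "\<exists>A. algorithm_on n A \<and>
                 real (num_queries A) \<le> 4 / (1 - 2 * c)\<^sup>2 * ln (real n) \<and>
                 finds_approx_max_cut c n A"
    by (rule exists_approx_max_cut_algorithm)
next
  have "real (query_complexity c n) \<le> 4 / (1 - 2 * c)\<^sup>2 * ln (real n)" if n: "n \<ge> 1" for n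
  proof -
    obtain A where A: "algorithm_on n A" "finds_approx_max_cut c n A"
      and le: "real (num_queries A) \<le> 4 / (1 - 2 * c)\<^sup>2 * ln (real n)"
      using exists_approx_max_cut_algorithm[OF assms n] by blast
    have "query_complexity c n \<le> num_queries A"
      unfolding query_complexity_def using A by (intro Least_le) blast
    with le show ?thesis by linarith
  qed
  \<comment> \<open>The bound was shown from \<open>n = 1\<close> on, where \<open>ln n\<close> is
    nonnegative and equals its norm.\<close>
  hence "\<forall>\<^sub>F n in at_top. norm (real (query_complexity c n)) \<le> 4 / (1 - 2 * c)\<^sup>2 * norm (ln (real n))"
    by (intro eventually_mono[OF eventually_ge_at_top[of 1]]) simp
  thus "(\<lambda>n. real (query_complexity c n)) \<in> O(\<lambda>n. ln (real n))"
    by (rule bigoI)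
qed

end
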